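(* Let $N\ge 3$ be an integer, $\alpha=\pi/N$, and $d\in\mathbb{R}$ with $|d|<1$; put $\rho=(1+d^2)/(d^2-1)$. For $t\in\mathbb{R}$ let $P=P(d,t)$ be the harmonic $N$-gon with consecutive vertices $w_1,\dots,w_N$ constructed in the context, and let $\theta_k$ be the internal angle of $P$ at $w_k$. Then the sums of cotangents and of squared cotangents of the internal angles do not depend on $t$, and $$\sum_{k=1}^N\cot\theta_k=N\rho\cot(2\alpha),\qquad \sum_{k=1}^N\cot^2\theta_k=N\,\frac{\rho^2(2+\cos(4\alpha))-1}{1-\cos(4\alpha)}.$$
   Context: Identify $\mathbb{R}^2$ with $\mathbb{C}$. Let $C$ be the unit circle centered at $0$. For $t\in\mathbb{R}$ put $z_k=e^{i(2\alpha k+t)}$, $k=1,\dots,N$ (indices modulo $N$); these are the vertices of a regular $N$-gon inscribed in $C$. For each $k$ let $w_k$ be the second intersection with $C$ of the line through $d$ and $z_k$, i.e. $w_k=\dfrac{d\bar z_k-1}{\bar z_k-d}$. The (convex, cyclic) polygon $P$ with consecutive vertices $w_1,\dots,w_N$ is the harmonic polygon associated with $d$ and $t$; for fixed $N,d$ the harmonic family is obtained by varying $t$. The internal angle $\theta_k\in(0,\pi)$ is $\angle w_{k-1}w_kw_{k+1}$. *)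

theory Defs
  imports "HOL-Analysis.Analysis"
begin

definition regular_vertex :: "nat \<Rightarrow> real \<Rightarrow> int \<Rightarrow> complex" where
  "regular_vertex N t k = cis (2 * (pi / real N) * of_int k + t)"

text \<open>
  For \<open>z\<close> on the unit circle, the point other than \<open>z\<close> in which the line through \<open>d\<close> and \<open>z\<close>
  meets the circle; see \<open>line_inter_circle\<close> and \<open>second_intersection_neq\<close> below.
\<close>

definition second_intersection :: "real \<Rightarrow> complex \<Rightarrow> complex" where
  "second_intersection d z = (of_real d * cnj z - 1) / (cnj z - of_real d)"

text \<open>
  A polygon is given by its vertices in cyclic order, indexed by the integers;
  \<open>harmonic_vertex_periodic\<close> shows that the indices may be read modulo \<open>N\<close>.
\<close>

definition harmonic_vertex :: "nat \<Rightarrow> real \<Rightarrow> real \<Rightarrow> int \<Rightarrow> complex" where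
  "harmonic_vertex N d t k = second_intersection d (regular_vertex N t k)"

definition angle_at :: "'a::real_inner \<Rightarrow> 'a \<Rightarrow> 'a \<Rightarrow> real" where
  "angle_at a b c = arccos (((a - b) \<bullet> (c - b)) / (norm (a - b) * norm (c - b)))"

text \<open>
  The unsigned angle is the internal angle because harmonic polygons are convex.
\<close>

definition internal_angle :: "(int \<Rightarrow> complex) \<Rightarrow> int \<Rightarrow> real" where
  "internal_angle w k = angle_at (w (k - 1)) (w k) (w (k + 1))"

lemma harmonic_vertex_periodic:
  assumes "N > 0"
  shows "harmonic_vertex N d t (k + int N) = harmonic_vertex N d t k"
proof -
  have "2 * (pi / real N) * of_int (k + int N) + t = (2 * (pi / real N) * of_int k + t) + 2 * pi"
    using assms by (simp add: field_simps)
  then have "regular_vertex N t (k + int N) = regular_vertex N t k"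
    unfolding regular_vertex_def by (metis cis_mult cis_2pi mult.right_neutral)
  then show ?thesis by (simp add: harmonic_vertex_def)
qed

lemma sphere_same_line:
  fixes b v :: complex
  assumes "norm b = 1" "norm (b + of_real s * v) = 1" "norm (b + of_real r * v) = 1"
    "s \<noteq> 0" "r \<noteq> 0" "v \<noteq> 0"
  shows "s = r"
proof -
  have *: "u * (2 * (b \<bullet> v) + u * (v \<bullet> v)) = 0" if "norm (b + of_real u * v) = 1" for u
  proof -
    have "(b + u *\<^sub>R v) \<bullet> (b + u *\<^sub>R v) = b \<bullet> b"
      using that assms(1) by (simp add: scaleR_conv_of_real dot_square_norm)
    then show ?thesis by (simp add: inner_simps inner_commute algebra_simps)
  qed
  from *[OF assms(2)] *[OF assms(3)] have "s * (v \<bullet> v) = r * (v \<bullet> v)"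
    using assms by (simp add: add_eq_0_iff2)
  then show ?thesis using assms by simp
qed

lemma circle_diff_nonzero:
  assumes "\<bar>d\<bar> < 1" "norm z = 1"
  shows "z - of_real d \<noteq> 0" "cnj z - of_real d \<noteq> 0"
  using assms by (auto, metis complex_mod_cnj norm_of_real less_irrefl)

lemma norm_second_intersection:
  assumes "\<bar>d\<bar> < 1" "norm z = 1"
  shows "norm (second_intersection d z) = 1"
proof -
  have zz: "z * cnj z = 1" using assms(2) by (simp add: complex_norm_square[symmetric])
  have "norm (of_real d * cnj z - 1) = norm (cnj z * (of_real d - z))"
    using zz by (simp add: algebra_simps)
  also have "\<dots> = norm (cnj (of_real d - z))"
    using assms(2) by (simp add: norm_mult del: complex_cnj_diff)
  also have "\<dots> = norm (cnj z - of_real d)" by (simp add: norm_minus_commute)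
  finally show ?thesis
    using circle_diff_nonzero[OF assms] by (simp add: second_intersection_def norm_divide)
qed

lemma second_intersection_on_line:
  assumes "\<bar>d\<bar> < 1" "norm z = 1"
  shows "second_intersection d z =
    of_real d + of_real (- (1 - d\<^sup>2) / (norm (z - of_real d))\<^sup>2) * (z - of_real d)"
proof -
  have n: "of_real ((norm (z - of_real d))\<^sup>2) = (z - of_real d) * (cnj z - of_real d)"
    using complex_norm_square[of "z - of_real d"] by simp
  show ?thesis
    using circle_diff_nonzero[OF assms]
    by (simp add: second_intersection_def n del: of_real_power)
       (simp add: divide_simps power2_eq_square algebra_simps)
qed

lemma second_intersection_neq:
  assumes "\<bar>d\<bar> < 1" "norm z = 1"
  shows "second_intersection d z \<noteq> z"
proof
  assume "second_intersection d z = z"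
  then have "(of_real (- (1 - d\<^sup>2) / (norm (z - of_real d))\<^sup>2) - 1) * (z - of_real d) = 0"
    using second_intersection_on_line[OF assms] by (simp add: algebra_simps)
  then have "- (1 - d\<^sup>2) / (norm (z - of_real d))\<^sup>2 = 1"
    using circle_diff_nonzero[OF assms] by (metis mult_eq_0_iff eq_iff_diff_eq_0 of_real_eq_1_iff)
  moreover have "- (1 - d\<^sup>2) / (norm (z - of_real d))\<^sup>2 \<le> 0"
    using assms(1) by (intro divide_nonpos_nonneg) (auto simp: abs_square_le_1)
  ultimately show False by linarith
qed

lemma line_inter_circle:
  assumes "\<bar>d\<bar> < 1" "norm z = 1"
  shows "sphere 0 1 \<inter> affine hull {of_real d, z} = {z, second_intersection d z}"
proof -
  define v where "v = of_real d - z"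
  have v: "v \<noteq> 0" using circle_diff_nonzero[OF assms] by (auto simp: v_def)
  have hull: "affine hull {of_real d, z} = {z + of_real u * v | u. True}"
    unfolding insert_commute[of "of_real d"] affine_hull_2_alt v_def
    by (auto simp: scaleR_conv_of_real image_def)
  define c where "c = 1 + (1 - d\<^sup>2) / (norm (z - of_real d))\<^sup>2"
  have si: "second_intersection d z = z + of_real c * v"
    unfolding second_intersection_on_line[OF assms] c_def v_def by (simp add: algebra_simps)
  have c: "c \<noteq> 0" using second_intersection_neq[OF assms] si by auto
  have nc: "norm (z + of_real c * v) = 1" using norm_second_intersection[OF assms] si by simp
  have only: "u = 0 \<or> u = c" if "norm (z + of_real u * v) = 1" for u
    using sphere_same_line[OF assms(2) that nc _ c v] by blast
  then show ?thesis unfolding hull si using assms(2)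
    by (auto intro: exI[of _ "0::real"] exI[of _ c] nc dest!: only)
qed

lemma second_intersection_inj:
  assumes "\<bar>d\<bar> < 1" "norm z = 1" "norm z' = 1" "second_intersection d z = second_intersection d z'"
  shows "z = z'"
proof -
  have "(of_real d * cnj z - 1) * (cnj z' - of_real d) = (of_real d * cnj z' - 1) * (cnj z - of_real d)"
    using assms circle_diff_nonzero by (simp add: second_intersection_def frac_eq_eq)
  then have "(1 - of_real (d\<^sup>2)) * (cnj z - cnj z') = 0"
    by (simp add: algebra_simps power2_eq_square)
  moreover have "(1::complex) - of_real (d\<^sup>2) \<noteq> 0"
    using assms(1) abs_square_eq_1[of d] by (metis eq_iff_diff_eq_0 less_irrefl of_real_eq_1_iff)
  ultimately show ?thesis by simp
qed

lemma regular_vertex_inj: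
  assumes "0 < i" "i < int N"
  shows "regular_vertex N t k \<noteq> regular_vertex N t (k + i)"
proof
  assume eq: "regular_vertex N t k = regular_vertex N t (k + i)"
  have "cis (2 * pi * of_int i / of_nat N) = cis ((2 * (pi / real N) * of_int (k + i) + t) - (2 * (pi / real N) * of_int k + t))"
    by (simp add: algebra_simps add_divide_distrib)
  also have "\<dots> = regular_vertex N t (k + i) / regular_vertex N t k"
    by (simp only: cis_divide regular_vertex_def)
  also have "\<dots> = 1" using eq by (simp add: regular_vertex_def)
  finally have "cos (2 * pi * of_int i / of_nat N) = 1" by (metis cis.sel(1) one_complex.sel(1))
  then obtain n :: int where n: "2 * pi * of_int i / real N = of_int n * 2 * pi"
    using cos_one_2pi_int by blast
  have "real_of_int i = real_of_int n * real N" using n assms by (simp add: field_simps)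
  then have "i = n * int N" by (metis of_int_eq_iff of_int_mult of_int_of_nat_eq)
  then have "int N dvd i" by simp
  with assms show False using zdvd_imp_le[of "int N" i] by linarith
qed

lemma angle_at_circle:
  fixes a b c :: complex
  assumes "norm a = 1" "norm b = 1" "norm c = 1" "a \<noteq> b" "b \<noteq> c" "a \<noteq> c"
  shows "angle_at a b c \<in> {0<..<pi}"
proof -
  let ?u = "a - b" and ?v = "c - b"
  have pos: "norm ?u * norm ?v > 0" using assms by simp
  have "\<bar>?u \<bullet> ?v\<bar> \<noteq> norm ?u * norm ?v"
  proof
    assume "\<bar>?u \<bullet> ?v\<bar> = norm ?u * norm ?v"
    then have "collinear {0, ?v, ?u}"
      using norm_cauchy_schwarz_equal[of ?u ?v] by (simp add: insert_commute)
    then obtain s where s: "?u = s *\<^sub>R ?v" using assms by (auto simp: collinear_lemma)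
    with assms have s0: "s \<noteq> 0" by auto
    have "s = 1"
      by (rule sphere_same_line[of b s ?v 1])
         (use assms s s0 in \<open>auto simp flip: scaleR_conv_of_real simp flip: s\<close>)
    with s assms show False by simp
  qed
  then have "\<bar>?u \<bullet> ?v\<bar> < norm ?u * norm ?v"
    using Cauchy_Schwarz_ineq2[of ?u ?v] by linarith
  then have "-1 < ?u \<bullet> ?v / (norm ?u * norm ?v)" "?u \<bullet> ?v / (norm ?u * norm ?v) < 1"
    using pos by (auto simp: pos_divide_less_eq pos_less_divide_eq)
  then show ?thesis unfolding angle_at_def using arccos_lt_bounded by auto
qed

lemma internal_angle_harmonic:
  assumes "N \<ge> 3" "\<bar>d\<bar> < 1"
  shows "internal_angle (harmonic_vertex N d t) k \<in> {0<..<pi}"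
proof -
  have nz: "norm (regular_vertex N t j) = 1" for j by (simp add: regular_vertex_def)
  have ne: "harmonic_vertex N d t j \<noteq> harmonic_vertex N d t (j + i)" if "0 < i" "i < int N" for i j
    using regular_vertex_inj[OF that] second_intersection_inj[OF assms(2) nz nz]
    unfolding harmonic_vertex_def by metis
  have two: "k - 1 + 2 = k + 1" by simp
  show ?thesis unfolding internal_angle_def
    by (rule angle_at_circle)
       (use assms ne[of 1 "k-1"] ne[of 1 k] ne[of 2 "k-1", unfolded two] norm_second_intersection[OF assms(2) nz]
         in \<open>auto simp: harmonic_vertex_def\<close>)
qed

end

theory Submission
  imports Defs
begin

text \<open>
  On the unit circle \<open>z \<mapsto> w\<close> is the Moebius map \<open>z \<mapsto> (d - z) / (1 - d z)\<close>. Hence, with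
  \<open>q = exp(2 i \<alpha>)\<close>, the edge ratio \<open>(w\<^sub>k\<^sub>-\<^sub>1 - w\<^sub>k) / (w\<^sub>k\<^sub>+\<^sub>1 - w\<^sub>k)\<close> is a positive multiple of
  \<open>2 d cos(arg z\<^sub>k) - (1/q + d\<^sup>2 q)\<close>, so that \<open>cot \<theta>\<^sub>k\<close> is an affine function of
  \<open>cos(arg z\<^sub>k)\<close>. Both sums then follow from the vanishing of \<open>\<Sum> exp(i m arg z\<^sub>k)\<close> for
  \<open>m = 1, 2\<close>; for \<open>m = 2\<close> this needs \<open>N \<ge> 3\<close>.
\<close>

text \<open>The terms form a geometric progression whose ratio \<open>cis x\<close> is an
  \<open>N\<close>-th root of unity other than 1.\<close>

lemma sum_cis_arithmetic_progression:
  assumes "cis x \<noteq> 1" "cis (real N * x) = 1"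
  shows "(\<Sum>k=1..int N. cis (x * of_int k + s)) = 0"
proof -
  have "(\<Sum>k=1..int N. cis (x * of_int k + s)) = (\<Sum>n=1..N. cis (x * real n + s))"
    by (rule sum.reindex_bij_witness[of _ int nat]) auto
  also have "\<dots> = (\<Sum>n=1..N. cis s * cis x ^ n)"
    by (simp add: cis_mult Complex.DeMoivre algebra_simps)
  \<comment> \<open>The sum starts at exponent 1, so one extra factor \<open>cis x\<close> moves
    into the prefactor.\<close>
  also have "\<dots> = cis (s + x) * (\<Sum>n<N. cis x ^ n)"
    by (simp add: sum_distrib_left sum.atLeast1_atMost_eq mult_ac flip: cis_mult)
  also have "(\<Sum>n<N. cis x ^ n) = 0"
    using assms(1) assms(2)[folded Complex.DeMoivre] by (simp add: geometric_sum)
  finally show ?thesis by simp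
qed

lemma sum_cos_arithmetic_progression:
  assumes "cis x \<noteq> 1" "cis (real N * x) = 1"
  shows "(\<Sum>k=1..int N. cos (x * of_int k + s)) = 0"
  using arg_cong[OF sum_cis_arithmetic_progression[OF assms], of Re s] by simp

lemma cis_root_of_unity_neq_1:
  assumes "0 < m" "m < N"
  shows "cis (2 * pi * real m / real N) \<noteq> 1"
proof
  assume "cis (2 * pi * real m / real N) = 1"
  then have "cos (2 * pi * real m / real N) = 1"
    by (metis cis.sel(1) one_complex.sel(1))
  then obtain n :: int where "2 * pi * real m / real N = of_int n * 2 * pi"
    using cos_one_2pi_int by blast
  then have "real m = of_int n * real N"
    using assms by (simp add: field_simps)
  then have "int m = n * int N"
    by (metis of_int_eq_iff of_int_mult of_int_of_nat_eq)
  then have "int N dvd int m" by simp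
  with assms show False using zdvd_imp_le[of "int N" "int m"] by linarith
qed

text \<open>The argument of the quotient is the oriented angle at \<open>b\<close> from
  \<open>c\<close> to \<open>a\<close>. A positive imaginary part puts it in the open interval from
  0 to \<pi>, where it agrees with the unsigned \<open>angle_at\<close>.\<close>

lemma cot_angle_at:
  fixes a b c :: complex
  assumes "Im ((a - b) / (c - b)) > 0"
  shows "cot (angle_at a b c) = Re ((a - b) / (c - b)) / Im ((a - b) / (c - b))"
proof -
  define r where "r = (a - b) / (c - b)"
  have c: "c - b \<noteq> 0" and r: "r \<noteq> 0" and Im: "Im r > 0"
    using assms by (auto simp: r_def)
  have a: "a - b = r * (c - b)" using c by (simp add: r_def)
  have "(a - b) \<bullet> (c - b) = Re r * (norm (c - b))\<^sup>2"
    unfolding a inner_complex_def cmod_power2 by (simp add: algebra_simps power2_eq_square)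
  moreover have "norm (a - b) = norm r * norm (c - b)" by (simp add: a norm_mult)
  ultimately have ang: "angle_at a b c = arccos (Re r / norm r)"
    using c by (simp add: angle_at_def power2_eq_square)
  have le: "\<bar>Re r / norm r\<bar> \<le> 1" using abs_Re_le_cmod[of r] r by simp
  have "(Im r)\<^sup>2 = (norm r)\<^sup>2 - (Re r)\<^sup>2" by (simp add: cmod_power2)
  then have "1 - (Re r / norm r)\<^sup>2 = (Im r / norm r)\<^sup>2"
    using r by (simp add: power_divide diff_divide_distrib)
  then have "sin (arccos (Re r / norm r)) = Im r / norm r"
    using le Im by (simp add: sin_arccos_abs)
  then have "cot (angle_at a b c) = Re r / Im r"
    using le r by (simp add: ang cot_def cos_arccos_abs)
  then show ?thesis by (simp add: r_def)
qed

text \<open>On the circle \<open>cnj z = 1 / z\<close>. The two denominators differ by the factor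
  \<open>z\<close>, so they vanish together and division by zero gives 0 on both sides.\<close>

lemma second_intersection_moebius:
  assumes "norm z = 1"
  shows "second_intersection d z = (of_real d - z) / (1 - of_real d * z)"
proof -
  have z: "z \<noteq> 0" "cnj z = 1 / z"
    using assms by (auto simp: divide_conv_cnj)
  show ?thesis
    using z by (simp add: second_intersection_def) (simp add: divide_simps)
qed

text \<open>The factor \<open>d\<^sup>2 - 1\<close> is the determinant of the Moebius map. It
  cancels in ratios of edges.\<close>

lemma second_intersection_diff:
  assumes "\<bar>d\<bar> < 1" "norm z = 1" "norm z' = 1"
  shows "second_intersection d z - second_intersection d z' =
    of_real (d\<^sup>2 - 1) * (z - z') / ((1 - of_real d * z) * (1 - of_real d * z'))"
proof -
  have "1 - of_real d * u \<noteq> 0" if "norm u = 1" for u :: complex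
  proof
    assume "1 - of_real d * u = 0"
    then have "norm (of_real d * u) = 1" by simp
    then show False using assms(1) that by (simp add: norm_mult)
  qed
  then show ?thesis
    using assms by (simp add: second_intersection_moebius diff_frac_eq power2_eq_square algebra_simps)
qed

lemma cot_internal_angle_harmonic:
  assumes N: "N \<ge> 3" and d: "\<bar>d\<bar> < 1"
  defines "\<beta> \<equiv> 2 * (pi / real N)"
  shows "cot (internal_angle (harmonic_vertex N d t) k) =
    (2 * d * cos (\<beta> * of_int k + t) - (1 + d\<^sup>2) * cos \<beta>) / ((1 - d\<^sup>2) * sin \<beta>)"
proof -
  define z where "z = regular_vertex N t"
  define w where "w = harmonic_vertex N d t"
  define q where "q = cis \<beta>"
  define M where "M = of_real (2 * d * cos (\<beta> * of_int k + t)) - (cnj q + of_real (d\<^sup>2) * q)"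
  have nz: "norm (z j) = 1" for j by (simp add: z_def regular_vertex_def)
  have q: "q * cnj q = 1" "q \<noteq> 0" by (simp_all add: q_def cis_cnj cis_mult)
  have zz: "z k * cnj (z k) = 1" by (simp add: z_def regular_vertex_def cis_cnj cis_mult)
  have prev: "z (k - 1) = z k * cnj q"
    by (simp add: z_def regular_vertex_def q_def \<beta>_def cis_cnj cis_mult algebra_simps diff_divide_distrib)
  have succ: "z (k + 1) = z k * q"
    by (simp add: z_def regular_vertex_def q_def \<beta>_def cis_mult algebra_simps add_divide_distrib)
  have \<beta>: "0 < \<beta>" "\<beta> < pi" using N by (simp_all add: \<beta>_def field_simps)
  have sin: "sin \<beta> > 0" using \<beta> by (rule sin_gt_zero)
  have q1: "q - 1 \<noteq> 0" using sin by (auto simp: q_def complex_eq_iff)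
  have d2: "1 - d\<^sup>2 > 0" using d by (simp add: abs_square_less_1)
  then have d2': "of_real (d\<^sup>2 - 1) \<noteq> (0::complex)"
    by (metis of_real_eq_0_iff less_irrefl minus_diff_eq neg_0_equal_iff_equal)
  have ne: "1 - of_real d * z j \<noteq> 0" for j
  proof
    assume "1 - of_real d * z j = 0"
    then have "norm (of_real d * z j) = 1" by simp
    then show False using d nz[of j] by (simp add: norm_mult)
  qed
  have zk: "z k \<noteq> 0" using nz[of k] by auto
  have cos: "of_real (2 * cos (\<beta> * of_int k + t)) = z k + cnj (z k)"
    by (simp add: complex_eq_iff z_def regular_vertex_def \<beta>_def)
  have diff: "w i - w j = of_real (d\<^sup>2 - 1) * (z i - z j) /
      ((1 - of_real d * z i) * (1 - of_real d * z j))" for i j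
    using second_intersection_diff[OF d nz nz, of i j]
    by (simp add: w_def harmonic_vertex_def z_def)
  \<comment> \<open>In the edge ratio the denominator at \<open>z k\<close> cancels and the one at
    \<open>z (k + 1)\<close> moves to the numerator. Only \<open>p\<close> stays below, and
    expanding by \<open>cnj p\<close> makes it the positive real
    \<open>(norm p)\<^sup>2\<close>.\<close>
  define p where "p = 1 - of_real d * z (k - 1)"
  have p: "p \<noteq> 0" "p * cnj p = of_real ((norm p)\<^sup>2)"
    using ne[of "k - 1"] complex_norm_square[of p] by (simp_all add: p_def)
  have edge: "cnj q - 1 = - cnj q * (q - 1)"
    using q by (simp add: algebra_simps)
  have "(w (k - 1) - w k) / (w (k + 1) - w k) =
      (z (k - 1) - z k) / (z (k + 1) - z k) * ((1 - of_real d * z (k + 1)) / p)"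
    unfolding diff p_def using d2' ne[of k] ne[of "k - 1"] ne[of "k + 1"]
    by (simp add: divide_simps)
  also have "(z (k - 1) - z k) / (z (k + 1) - z k) = (cnj q - 1) / (q - 1)"
    unfolding prev succ using zk by (simp add: divide_simps) (simp add: algebra_simps)
  \<comment> \<open>This is the edge ratio of the regular polygon, with argument \<pi> - \<beta>,
    its interior angle.\<close>
  also have "\<dots> = - cnj q" unfolding edge using q1 by simp
  also have "- cnj q * ((1 - of_real d * z (k + 1)) / p) =
      (- cnj q * (1 - of_real d * z (k + 1)) * cnj p) / of_real ((norm p)\<^sup>2)"
    unfolding p(2)[symmetric] using p(1) by simp
  also have "- cnj q * (1 - of_real d * z (k + 1)) * cnj p = M"
  proof -
    have "M = of_real d * (z k + cnj (z k)) - (cnj q + of_real d * of_real d * q)"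
      unfolding cos[symmetric] M_def by (simp add: power2_eq_square)
    moreover have "- cnj q * (1 - of_real d * z (k + 1)) * cnj p = \<dots>"
      unfolding p_def succ prev complex_cnj_diff complex_cnj_mult complex_cnj_one
        complex_cnj_cnj complex_cnj_complex_of_real
      using q(1) zz by algebra
    ultimately show ?thesis by simp
  qed
  finally have ratio: "(w (k - 1) - w k) / (w (k + 1) - w k) = M / of_real ((norm p)\<^sup>2)" .
  have M: "Re M = 2 * d * cos (\<beta> * of_int k + t) - (1 + d\<^sup>2) * cos \<beta>"
    "Im M = (1 - d\<^sup>2) * sin \<beta>"
    by (simp_all add: M_def q_def algebra_simps del: of_real_power of_real_mult)
  \<comment> \<open>Positivity means that the polygon turns left at \<open>w k\<close>, so the
    oriented angle is the internal one.\<close>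
  have "Im (M / of_real ((norm p)\<^sup>2)) > 0"
    unfolding Im_divide_of_real M using sin d2 p(1) by simp
  then have "cot (internal_angle w k) = Re M / Im M"
    unfolding internal_angle_def ratio[symmetric]
    by (subst cot_angle_at) (use p(1) in \<open>simp_all add: ratio del: of_real_power\<close>)
  then show ?thesis unfolding M w_def .
qed

theorem proposition3:
  fixes N :: nat and d \<alpha> \<rho> :: real and \<theta> :: "real \<Rightarrow> int \<Rightarrow> real"
  assumes "N \<ge> 3"
    and "\<alpha> = pi / real N"
    and "\<bar>d\<bar> < 1"
    and "\<rho> = (1 + d\<^sup>2) / (d\<^sup>2 - 1)"
    and "\<And>t k. \<theta> t k = internal_angle (harmonic_vertex N d t) k"
  shows "(\<lambda>t. \<Sum>k=1..int N. cot (\<theta> t k)) constant_on UNIV \<and>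
    (\<lambda>t. \<Sum>k=1..int N. (cot (\<theta> t k))\<^sup>2) constant_on UNIV \<and>
    (\<forall>t. (\<Sum>k=1..int N. cot (\<theta> t k)) = real N * \<rho> * cot (2 * \<alpha>)) \<and>
    (\<forall>t. (\<Sum>k=1..int N. (cot (\<theta> t k))\<^sup>2) =
      real N * ((\<rho>\<^sup>2 * (2 + cos (4 * \<alpha>)) - 1) / (1 - cos (4 * \<alpha>))))"
proof -
  define \<beta> where "\<beta> = 2 * (pi / real N)"
  \<comment> \<open>\<open>B\<close> and \<open>A\<close> are the cosine coefficient and the
    constant term of the cotangent as an affine function of the cosine. As the cosines sum to 0,
    \<open>A\<close> is the mean cotangent.\<close>
  define B where "B = 2 * d / ((1 - d\<^sup>2) * sin \<beta>)"
  define A where "A = \<rho> * cot \<beta>"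
  have \<alpha>: "2 * \<alpha> = \<beta>" "4 * \<alpha> = 2 * \<beta>" by (simp_all add: \<beta>_def assms(2))
  have "0 < \<beta>" "\<beta> < pi" using assms(1) by (simp_all add: \<beta>_def field_simps)
  then have sin: "sin \<beta> > 0" by (rule sin_gt_zero)
  have d2: "1 - d\<^sup>2 > 0" using assms(3) by (simp add: abs_square_less_1)
  have \<rho>: "\<rho> = - ((1 + d\<^sup>2) / (1 - d\<^sup>2))"
    unfolding assms(4) minus_divide_right by simp
  have cot: "cot (\<theta> t k) = A + B * cos (\<beta> * of_int k + t)" for t k
    unfolding assms(5) cot_internal_angle_harmonic[OF assms(1,3)] \<beta>_def[symmetric]
    unfolding A_def B_def \<rho> cot_def by (simp add: diff_divide_distrib)
  have "cis (2 * pi * real 1 / real N) \<noteq> 1" "cis (2 * pi * real 2 / real N) \<noteq> 1"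
    using assms(1) by (intro cis_root_of_unity_neq_1; simp)+
  then have "cis \<beta> \<noteq> 1" "cis (2 * \<beta>) \<noteq> 1" by (simp_all add: \<beta>_def mult_ac)
  moreover have "real N * \<beta> = 2 * pi" using assms(1) by (simp add: \<beta>_def)
  then have "cis (real N * \<beta>) = 1" by simp
  moreover from this have "cis (real N * (2 * \<beta>)) = 1"
    by (metis cis_mult distrib_left mult_1 mult_2)
  ultimately have cos1: "(\<Sum>k=1..int N. cos (\<beta> * of_int k + t)) = 0"
    and cos2: "(\<Sum>k=1..int N. cos (2 * \<beta> * of_int k + 2 * t)) = 0" for t
    by (simp_all add: sum_cos_arithmetic_progression)
  have double: "cos (2 * \<beta> * of_int k + 2 * t) = 2 * (cos (\<beta> * of_int k + t))\<^sup>2 - 1" for t k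
    using cos_double_cos[of "\<beta> * of_int k + t"] by (simp add: algebra_simps)
  have sum1: "(\<Sum>k=1..int N. cot (\<theta> t k)) = real N * A" for t
    using cos1[of t] by (simp add: cot sum.distrib flip: sum_distrib_left)
  \<comment> \<open>The double-angle formula makes the square linear in cosines that sum to 0 over
    \<open>k\<close>.\<close>
  have "(cot (\<theta> t k))\<^sup>2 = (A\<^sup>2 + B\<^sup>2 / 2) + 2 * A * B * cos (\<beta> * of_int k + t) +
      B\<^sup>2 / 2 * cos (2 * \<beta> * of_int k + 2 * t)" for t k
    unfolding cot double by (simp add: power2_eq_square algebra_simps)
  then have sum2: "(\<Sum>k=1..int N. (cot (\<theta> t k))\<^sup>2) = real N * (A\<^sup>2 + B\<^sup>2 / 2)" for t
    using cos1[of t] cos2[of t]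
    by (simp add: sum.distrib flip: sum_distrib_left sum_divide_distrib)
  \<comment> \<open>This eliminates \<open>d\<close> in favour of \<rho>.\<close>
  have B2: "B\<^sup>2 = (\<rho>\<^sup>2 - 1) / (sin \<beta>)\<^sup>2"
  proof -
    have "4 * d\<^sup>2 = (1 + d\<^sup>2)\<^sup>2 - (1 - d\<^sup>2)\<^sup>2" by (simp add: power2_eq_square algebra_simps)
    then have "4 * d\<^sup>2 / (1 - d\<^sup>2)\<^sup>2 = \<rho>\<^sup>2 - 1"
      unfolding \<rho> using d2 by (simp add: power_divide diff_divide_distrib)
    then show ?thesis by (simp add: B_def power_divide power_mult_distrib flip: divide_divide_eq_left)
  qed
  have "A\<^sup>2 + B\<^sup>2 / 2 = (\<rho>\<^sup>2 * (2 * (cos \<beta>)\<^sup>2 + 1) - 1) / (2 * (sin \<beta>)\<^sup>2)"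
    unfolding A_def B2 cot_def using sin by (simp add: field_simps)
  also have "\<dots> = (\<rho>\<^sup>2 * (2 + cos (4 * \<alpha>)) - 1) / (1 - cos (4 * \<alpha>))"
    unfolding \<alpha> cos_double_cos sin_squared_eq by (simp add: algebra_simps)
  finally have AB: "A\<^sup>2 + B\<^sup>2 / 2 = \<dots>" .
  \<comment> \<open>Constancy in \<open>t\<close> is immediate, since the values in
    \<open>sum1\<close> and \<open>sum2\<close> do not contain \<open>t\<close>.\<close>
  show ?thesis
    unfolding constant_on_def sum1 sum2 AB[symmetric] \<alpha>(1) by (simp add: A_def)
qed

end
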